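(* Let $A_1,\ldots,A_r\in\mathbb{R}_+^{n\times n}$ commute in pairs in max algebra, with $\lambda(A_i)=1$ for $i=1,\ldots,r$. Then $$V(A_1,1)\cap\cdots\cap V(A_r,1)=\operatorname{Im}(Q(A_1))\cap\cdots\cap\operatorname{Im}(Q(A_r))=V(Q(A_1)\cdots Q(A_r),1).$$ This intersection contains a nonzero vector if and only if the Perron root of $Q(A_1)\cdots Q(A_r)$ is $1$, in which case the intersection is the principal eigencone of $Q(A_1)\cdots Q(A_r)$.
   Context: Max algebra is the semiring $(\mathbb{R}_+,\oplus,\times)$, where $\mathbb{R}_+=[0,\infty)$, $a\oplus b=\max(a,b)$ and $\times$ is ordinary multiplication. All matrix and matrix-vector operations are over this semiring: $(AB)_{ij}=\max_k a_{ik}b_{kj}$, $(Av)_i=\max_k a_{ik}v_k$, and $A^m$ is the iterated max-algebraic product. For $\alpha\in\mathbb{R}_+$, $V(A,\alpha)=\{v\in\mathbb{R}_+^n\mid Av=\alpha v\}$; $\alpha$ is an eigenvalue of $A$ if $V(A,\alpha)$ contains a nonzero vector. The Perron root $\lambda(A)$ is the largest eigenvalue of $A$; it equals $\max_{1\le k\le n}\max_{i_1,\ldots,i_k}(a_{i_1i_2}\cdots a_{i_ki_1})^{1/k}$. The principal eigencone of $A$ is $V(A,\lambda(A))$. $\operatorname{Im}(X)=\{Xu\mid u\in\mathbb{R}_+^n\}$ for $X\in\mathbb{R}_+^{n\times n}$. For $A$ with $\lambda(A)=1$, define the spectral projector $Q(A)=\lim_{p\to\infty}\bigoplus_{m\geq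 p}A^m$ (entrywise supremum over $m\ge p$, then entrywise limit). Equivalently, $Q(A)=\bigoplus_{i\in N_c^A}A^*_{\cdot i}A^*_{i\cdot}$, where $A^*=I\oplus A\oplus A^2\oplus\cdots$, $A^*_{\cdot i}$ and $A^*_{i\cdot}$ are its $i$th column and row, and $N_c^A$ is the set of indices lying on cycles attaining the maximum in the formula for $\lambda(A)$. *)

theory Defs
  imports "HOL-Analysis.Analysis"
begin

text \<open>
  Max algebra over the nonnegative reals. Vectors and matrices have type \<open>real ^ 'n\<close> and
  \<open>real ^ 'n ^ 'n\<close>; membership in \<open>[0, \<infinity>)\<close> is stated explicitly. The index type is finite and
  nonempty, so every \<open>Max\<close> below is an attained maximum.
\<close>

definition nonneg_vec :: "real ^ 'n \<Rightarrow> bool" where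
  "nonneg_vec v \<longleftrightarrow> (\<forall>i. 0 \<le> v $ i)"

definition nonneg_mat :: "real ^ 'n ^ 'n \<Rightarrow> bool" where
  "nonneg_mat A \<longleftrightarrow> (\<forall>i j. 0 \<le> A $ i $ j)"

definition max_mult :: "real ^ 'n ^ 'n \<Rightarrow> real ^ 'n ^ 'n \<Rightarrow> real ^ 'n ^ 'n"
    (infixl "\<otimes>" 70) where
  "A \<otimes> B = (\<chi> i j. MAX k. A $ i $ k * B $ k $ j)"

definition max_mult_vec :: "real ^ 'n ^ 'n \<Rightarrow> real ^ 'n \<Rightarrow> real ^ 'n"
    (infixr "\<otimes>\<^sub>v" 70) where
  "A \<otimes>\<^sub>v v = (\<chi> i. MAX k. A $ i $ k * v $ k)"

text \<open>On nonnegative matrices, the usual identity matrix is also the unit of \<open>\<otimes>\<close>.\<close>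

primrec max_pow :: "real ^ 'n ^ 'n \<Rightarrow> nat \<Rightarrow> real ^ 'n ^ 'n" where
  "max_pow A 0 = mat 1"
| "max_pow A (Suc m) = max_pow A m \<otimes> A"

definition max_prod_list :: "(real ^ 'n ^ 'n) list \<Rightarrow> real ^ 'n ^ 'n" where
  "max_prod_list Xs = foldr (\<otimes>) Xs (mat 1)"

definition eigencone :: "real ^ 'n ^ 'n \<Rightarrow> real \<Rightarrow> (real ^ 'n) set" where
  "eigencone A \<alpha> = {v. nonneg_vec v \<and> A \<otimes>\<^sub>v v = \<alpha> *\<^sub>R v}"

definition max_eigenvalue :: "real ^ 'n ^ 'n \<Rightarrow> real \<Rightarrow> bool" where
  "max_eigenvalue A \<alpha> \<longleftrightarrow> 0 \<le> \<alpha> \<and> (\<exists>v \<in> eigencone A \<alpha>. v \<noteq> 0)"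

definition perron_root :: "real ^ 'n ^ 'n \<Rightarrow> real" where
  "perron_root A = (GREATEST \<alpha>. max_eigenvalue A \<alpha>)"

definition principal_eigencone :: "real ^ 'n ^ 'n \<Rightarrow> (real ^ 'n) set" where
  "principal_eigencone A = eigencone A (perron_root A)"

definition max_image :: "real ^ 'n ^ 'n \<Rightarrow> (real ^ 'n) set" where
  "max_image X = {X \<otimes>\<^sub>v u | u. nonneg_vec u}"

text \<open>
  Meaningful for nonnegative \<open>A\<close> with \<open>perron_root A = 1\<close>: then the powers of \<open>A\<close> are entrywise
  bounded, so the suprema are genuine and their limit exists.
\<close>

definition spectral_proj :: "real ^ 'n ^ 'n \<Rightarrow> real ^ 'n ^ 'n" where
  "spectral_proj A = (\<chi> i j. lim (\<lambda>p::nat. SUP m\<in>{p..}. max_pow A m $ i $ j))"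

end

theory Submission
  imports Defs
begin

text \<open>Since all powers of \<open>A\<close> are bounded when its Perron root is \<open>1\<close>, the projector \<open>Q(A)\<close> is the
  entrywise upper limit of \<open>A\<^sup>m\<close>. An upper limit commutes with finite maxima and with multiplication by
  nonnegative constants (\<open>seq_limsup_MAX\<close>), so it passes through every max-algebraic product.
  Taking upper limits in \<open>A A\<^sup>m = A\<^sup>m\<^sup>+\<^sup>1\<close> gives \<open>A Q(A) = Q(A)\<close>, and in \<open>A\<^sup>m v = v\<close> gives
  \<open>Q(A) v = v\<close> for every \<open>v\<close> in \<open>V(A,1)\<close>. Hence \<open>V(A,1) = Im Q(A) = V(Q(A),1)\<close> and \<open>Q(A)\<close> is
  idempotent. In the same way \<open>Q(A)\<close> commutes with everything that commutes with \<open>A\<close>, so the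
  projectors \<open>Q(A\<^sub>i)\<close> commute.

  Their product \<open>P\<close> therefore satisfies \<open>Q(A\<^sub>i) P = P\<close> for each \<open>i\<close>. So \<open>P v = v\<close> forces
  \<open>Q(A\<^sub>i) v = Q(A\<^sub>i) P v = P v = v\<close>, which identifies \<open>V(P,1)\<close> with the intersection of the
  eigencones. Moreover \<open>P\<close> is idempotent, so its eigenvalues lie in \<open>{0, 1}\<close>, and one of the two
  occurs: a nonzero column of \<open>P\<close> is an eigenvector for \<open>1\<close>, while \<open>P = 0\<close> has the eigenvalue \<open>0\<close>
  only. Its Perron root is thus \<open>1\<close> exactly when \<open>V(P,1)\<close> is nontrivial
  (\<open>perron_root_idempotent\<close>).

  What remains is the boundedness of the powers (\<open>power_bounded_if_perron_root_1\<close>), where the Perron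
  root is known only as the largest eigenvalue. If no cycle of length at most \<open>n\<close> has weight above
  \<open>1\<close>, cutting cycles out of a long walk bounds its weight by that of a walk shorter than \<open>n\<close>.
  For the link to eigenvalues, let \<open>\<mu>\<close> be the largest geometric mean of such a cycle. If
  \<open>\<mu> > 0\<close>, the powers of \<open>A / \<mu>\<close> are bounded, and the column of \<open>Q(A / \<mu>)\<close> at a node of a critical
  cycle is a nonzero eigenvector of \<open>A\<close> for \<open>\<mu>\<close>; boundedness also excludes larger eigenvalues.
  Hence \<open>\<mu>\<close> is the Perron root, and Perron root \<open>1\<close> leaves only \<open>\<mu> \<le> 1\<close>.\<close>

section \<open>Finite maxima and max-algebraic products\<close>

lemma MAX_le_iff: "(MAX k. f k) \<le> c \<longleftrightarrow> (\<forall>k. f k \<le> c)"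
  for f :: "'n::finite \<Rightarrow> real"
  by (subst Max_le_iff) auto

lemma MAX_ge: "f k \<le> (MAX k. f k)"
  for f :: "'n::finite \<Rightarrow> real"
  by (rule Max_ge) auto

lemma MAX_attained: "\<exists>k. (MAX k. f k) = f k"
  for f :: "'n::finite \<Rightarrow> real"
proof -
  have "Max (range f) \<in> range f" by (rule Max_in) auto
  then show ?thesis by (simp add: image_iff)
qed

lemma MAX_eqI: "(\<And>k. f k \<le> c) \<Longrightarrow> f a = c \<Longrightarrow> (MAX k. f k) = c"
  for f :: "'n::finite \<Rightarrow> real"
  using MAX_ge[of f a] by (intro antisym) (auto simp: MAX_le_iff)

lemma MAX_mult_left: "0 \<le> c \<Longrightarrow> c * (MAX k. f k) = (MAX k. c * f k)"
  for f :: "'n::finite \<Rightarrow> real"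
proof -
  assume c: "0 \<le> c"
  obtain k where k: "(MAX k. f k) = f k" using MAX_attained by blast
  have "(MAX k. c * f k) = c * f k"
    by (rule MAX_eqI[OF _ refl]) (metis c k MAX_ge mult_left_mono)
  then show ?thesis by (simp add: k)
qed

lemma MAX_swap: "(MAX k. MAX l. f k l) = (MAX l. MAX k. f k l)"
  for f :: "'n::finite \<Rightarrow> 'm::finite \<Rightarrow> real"
proof (intro antisym)
  show "(MAX k. MAX l. f k l) \<le> (MAX l. MAX k. f k l)"
    by (simp add: MAX_le_iff) (meson MAX_ge order_trans)
  show "(MAX l. MAX k. f k l) \<le> (MAX k. MAX l. f k l)"
    by (simp add: MAX_le_iff) (meson MAX_ge order_trans)
qed

lemma max_mult_nth: "(A \<otimes> B) $ i $ j = (MAX k. A $ i $ k * B $ k $ j)"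
  by (simp add: max_mult_def)

lemma max_mult_vec_nth: "(A \<otimes>\<^sub>v v) $ i = (MAX k. A $ i $ k * v $ k)"
  by (simp add: max_mult_vec_def)

lemma nonneg_matD: "nonneg_mat A \<Longrightarrow> 0 \<le> A $ i $ j"
  by (simp add: nonneg_mat_def)

lemma nonneg_max_mult: "nonneg_mat A \<Longrightarrow> nonneg_mat B \<Longrightarrow> nonneg_mat (A \<otimes> B)"
  unfolding nonneg_mat_def max_mult_nth
  by (meson MAX_ge mult_nonneg_nonneg order_trans)

lemma nonneg_max_mult_vec: "nonneg_mat A \<Longrightarrow> nonneg_vec v \<Longrightarrow> nonneg_vec (A \<otimes>\<^sub>v v)"
  unfolding nonneg_mat_def nonneg_vec_def max_mult_vec_nth
  by (meson MAX_ge mult_nonneg_nonneg order_trans)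

lemma nonneg_mat_one: "nonneg_mat (mat 1)"
  by (simp add: nonneg_mat_def mat_def)

lemma nonneg_max_pow: "nonneg_mat A \<Longrightarrow> nonneg_mat (max_pow A m)"
  by (induction m) (auto intro: nonneg_mat_one nonneg_max_mult)

lemma max_mult_assoc:
  assumes "nonneg_mat A" "nonneg_mat C"
  shows "(A \<otimes> B) \<otimes> C = A \<otimes> (B \<otimes> C)"
proof -
  have "(MAX l. (MAX k. A $ i $ k * B $ k $ l) * C $ l $ j)
      = (MAX k. A $ i $ k * (MAX l. B $ k $ l * C $ l $ j))" for i j
  proof -
    have "(MAX l. (MAX k. A $ i $ k * B $ k $ l) * C $ l $ j)
        = (MAX l. MAX k. C $ l $ j * (A $ i $ k * B $ k $ l))"
      using assms by (simp add: MAX_mult_left nonneg_matD mult.commute[of _ "C $ _ $ j"])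
    also have "\<dots> = (MAX k. MAX l. A $ i $ k * (B $ k $ l * C $ l $ j))"
      by (subst MAX_swap) (simp add: mult_ac)
    finally show ?thesis
      using assms by (simp add: MAX_mult_left nonneg_matD)
  qed
  then show ?thesis by (simp add: vec_eq_iff max_mult_nth)
qed

lemma column_max_mult: "column j (A \<otimes> B) = A \<otimes>\<^sub>v column j B"
  by (simp add: vec_eq_iff column_def max_mult_nth max_mult_vec_nth)

text \<open>A vector is a column of the matrix all of whose columns are that vector, so the law for
  matrices carries over.\<close>

lemma max_mult_vec_assoc:
  assumes "nonneg_mat A" "nonneg_vec v"
  shows "(A \<otimes> B) \<otimes>\<^sub>v v = A \<otimes>\<^sub>v (B \<otimes>\<^sub>v v)"
proof -
  define C where "C = (\<chi> i (j::'a). v $ i)"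
  have "nonneg_mat C" using assms(2) by (simp add: C_def nonneg_mat_def nonneg_vec_def)
  moreover have "column j C = v" for j by (simp add: C_def column_def)
  ultimately show ?thesis
    using max_mult_assoc[OF assms(1), of C B] by (metis column_max_mult)
qed

lemma max_mult_vec_scale:
  assumes "0 \<le> c"
  shows "(c *\<^sub>R A) \<otimes>\<^sub>v v = c *\<^sub>R (A \<otimes>\<^sub>v v)" "A \<otimes>\<^sub>v (c *\<^sub>R v) = c *\<^sub>R (A \<otimes>\<^sub>v v)"
  using assms by (simp_all add: vec_eq_iff max_mult_vec_nth MAX_mult_left mult_ac)

lemma max_mult_scale:
  assumes "0 \<le> c"
  shows "(c *\<^sub>R A) \<otimes> B = c *\<^sub>R (A \<otimes> B)" "A \<otimes> (c *\<^sub>R B) = c *\<^sub>R (A \<otimes> B)"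
  using assms by (simp_all add: vec_eq_iff max_mult_nth MAX_mult_left mult_ac)

lemma max_mult_one_left: "nonneg_mat A \<Longrightarrow> mat 1 \<otimes> A = A"
  unfolding vec_eq_iff max_mult_nth
  by (intro allI, rule_tac a = i in MAX_eqI) (auto simp: mat_def nonneg_matD)

lemma max_mult_one_right: "nonneg_mat A \<Longrightarrow> A \<otimes> mat 1 = A"
  unfolding vec_eq_iff max_mult_nth
  by (intro allI, rule_tac a = ia in MAX_eqI) (auto simp: mat_def nonneg_matD)

lemma max_mult_vec_one: "nonneg_vec v \<Longrightarrow> mat 1 \<otimes>\<^sub>v v = v"
  unfolding vec_eq_iff max_mult_vec_nth
  by (intro allI, rule_tac a = i in MAX_eqI) (auto simp: mat_def nonneg_vec_def)

lemma max_pow_commute: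
  assumes "nonneg_mat A" "nonneg_mat B" "A \<otimes> B = B \<otimes> A"
  shows "max_pow A m \<otimes> B = B \<otimes> max_pow A m"
proof (induction m)
  case 0
  then show ?case using assms by (simp add: max_mult_one_left max_mult_one_right)
next
  case (Suc m)
  have "max_pow A (Suc m) \<otimes> B = max_pow A m \<otimes> (B \<otimes> A)"
    using assms by (simp add: max_mult_assoc nonneg_max_pow)
  also have "\<dots> = (B \<otimes> max_pow A m) \<otimes> A"
    using assms Suc by (simp flip: max_mult_assoc add: nonneg_max_pow)
  finally show ?case
    using assms by (simp add: max_mult_assoc nonneg_max_pow)
qed

lemma max_pow_Suc_left: "nonneg_mat A \<Longrightarrow> A \<otimes> max_pow A m = max_pow A (Suc m)"
  using max_pow_commute[of A A m] by simp

lemma max_pow_add: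
  "nonneg_mat A \<Longrightarrow> max_pow A (s + t) = max_pow A s \<otimes> max_pow A t"
  by (induction t) (simp_all add: max_mult_one_right max_mult_assoc nonneg_max_pow)

lemma max_pow_scale: "0 \<le> c \<Longrightarrow> max_pow (c *\<^sub>R A) m = c ^ m *\<^sub>R max_pow A m"
  by (induction m) (simp_all add: max_mult_scale mult_ac)

lemma max_pow_mult_vec_eigen:
  assumes "nonneg_mat A" "0 \<le> \<alpha>" "v \<in> eigencone A \<alpha>"
  shows "max_pow A m \<otimes>\<^sub>v v = \<alpha> ^ m *\<^sub>R v"
  using assms
  by (induction m)
    (auto simp: eigencone_def max_mult_vec_one max_mult_vec_assoc nonneg_max_pow max_mult_vec_scale)

section \<open>Boundedness of powers\<close>

definition power_bounded :: "real ^ 'n ^ 'n \<Rightarrow> bool" where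
  "power_bounded A \<longleftrightarrow> (\<exists>C. \<forall>m i j. max_pow A m $ i $ j \<le> C)"

lemma max_pow_attained_by_walk:
  assumes "nonneg_mat A"
  shows "\<exists>f. f 0 = i \<and> f (Suc m) = j \<and>
    max_pow A (Suc m) $ i $ j = (\<Prod>l<Suc m. A $ f l $ f (Suc l))"
proof (induction m arbitrary: j)
  case 0
  have "max_pow A (Suc 0) $ i $ j = A $ i $ j"
    by (simp add: max_mult_one_left assms)
  then show ?case
    by (intro exI[of _ "\<lambda>l. if l = 0 then i else j"]) simp
next
  case (Suc m)
  obtain k where k: "max_pow A (Suc (Suc m)) $ i $ j = max_pow A (Suc m) $ i $ k * A $ k $ j"
    using MAX_attained[of "\<lambda>k. max_pow A (Suc m) $ i $ k * A $ k $ j"]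
    by (metis max_mult_nth max_pow.simps(2))
  obtain f where f: "f 0 = i" "f (Suc m) = k"
    "max_pow A (Suc m) $ i $ k = (\<Prod>l<Suc m. A $ f l $ f (Suc l))"
    using Suc.IH by blast
  define g where "g = f (Suc (Suc m) := j)"
  have "(\<Prod>l<Suc m. A $ g l $ g (Suc l)) = (\<Prod>l<Suc m. A $ f l $ f (Suc l))"
    by (rule prod.cong) (auto simp: g_def)
  moreover have "(\<Prod>l<Suc (Suc m). A $ g l $ g (Suc l))
      = (\<Prod>l<Suc m. A $ g l $ g (Suc l)) * A $ k $ j"
    using f(2) by (simp only: prod.lessThan_Suc[of _ "Suc m"]) (simp add: g_def)
  ultimately show ?case
    using k f by (intro exI[of _ g]) (simp add: g_def)
qed

lemma walk_weight_le_max_pow: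
  assumes "nonneg_mat A"
  shows "(\<Prod>l\<in>{s..<s + d}. A $ f l $ f (Suc l)) \<le> max_pow A d $ f s $ f (s + d)"
proof (induction d)
  case 0
  then show ?case by (simp add: mat_def)
next
  case (Suc d)
  have "(\<Prod>l\<in>{s..<s + Suc d}. A $ f l $ f (Suc l))
      \<le> max_pow A d $ f s $ f (s + d) * A $ f (s + d) $ f (Suc (s + d))"
    using Suc assms by (simp add: mult_right_mono nonneg_matD)
  also have "\<dots> \<le> max_pow A (Suc d) $ f s $ f (s + Suc d)"
    using MAX_ge[of "\<lambda>k. max_pow A d $ f s $ k * A $ k $ f (Suc (s + d))" "f (s + d)"]
    by (simp add: max_mult_nth)
  finally show ?case .
qed

text \<open>Two of the first \<open>n + 1\<close> positions of a walk with at least \<open>n\<close> steps coincide. The closed part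
  between them has weight at most \<open>1\<close>, so removing it does not decrease the weight.\<close>

lemma max_pow_le_short_max_pow:
  fixes A :: "real ^ 'n ^ 'n"
  assumes A: "nonneg_mat A"
    and cyc: "\<And>k i. 1 \<le> k \<Longrightarrow> k \<le> CARD('n) \<Longrightarrow> max_pow A k $ i $ i \<le> 1"
  shows "\<exists>k<CARD('n). max_pow A m $ i $ j \<le> max_pow A k $ i $ j"
proof (induction m rule: less_induct)
  case (less m)
  show ?case
  proof (cases "m < CARD('n)")
    case True
    then show ?thesis by auto
  next
    case False
    then obtain m' where m': "m = Suc m'" by (metis not0_implies_Suc zero_less_card_finite)
    obtain f where f: "f 0 = i" "f m = j"
      and w: "max_pow A m $ i $ j = (\<Prod>l\<in>{0..<m}. A $ f l $ f (Suc l))"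
      using max_pow_attained_by_walk[OF A, of i m' j] unfolding m' atLeast0LessThan by blast
    have "\<not> inj_on f {..CARD('n)}"
      using card_inj_on_le[of f "{..CARD('n)}" UNIV] by auto
    then obtain s t where st: "s < t" "t \<le> CARD('n)" "f s = f t"
      unfolding inj_on_def by (metis atMost_iff linorder_neqE_nat)
    define W where "W a b = (\<Prod>l\<in>{a..<b}. A $ f l $ f (Suc l))" for a b
    have W: "W a b \<le> max_pow A (b - a) $ f a $ f b" if "a \<le> b" for a b
      using walk_weight_le_max_pow[OF A, of f a "b - a"] that by (simp add: W_def)
    have W0: "0 \<le> W a b" for a b
      unfolding W_def by (intro prod_nonneg) (simp add: nonneg_matD A)
    have tm: "t \<le> m" using st False by simp
    have "max_pow A m $ i $ j = W 0 s * W s t * W t m"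
      unfolding w W_def using st tm by (simp add: prod.atLeastLessThan_concat)
    also have "\<dots> \<le> W 0 s * 1 * W t m"
    proof -
      have "1 \<le> t - s" "t - s \<le> CARD('n)" using st by linarith+
      then have "W s t \<le> 1"
        using W[of s t] cyc[of "t - s" "f t"] st by simp
      then show ?thesis by (intro mult_right_mono mult_left_mono W0)
    qed
    also have "\<dots> \<le> max_pow A s $ i $ f s * max_pow A (m - t) $ f s $ j"
      using W[of 0 s] W[of t m] st tm f by (auto intro!: mult_mono W0 nonneg_matD nonneg_max_pow A)
    also have "\<dots> \<le> max_pow A (s + (m - t)) $ i $ j"
      unfolding max_pow_add[OF A] max_mult_nth by (rule MAX_ge)
    finally have le: "max_pow A m $ i $ j \<le> max_pow A (s + (m - t)) $ i $ j" .
    have "s + (m - t) < m" using st tm by simp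
    from less.IH[OF this] le show ?thesis by (meson order_trans)
  qed
qed

lemma power_bounded_if_cycles_le_1:
  fixes A :: "real ^ 'n ^ 'n"
  assumes A: "nonneg_mat A"
    and cyc: "\<And>k i. 1 \<le> k \<Longrightarrow> k \<le> CARD('n) \<Longrightarrow> max_pow A k $ i $ i \<le> 1"
  shows "power_bounded A"
proof -
  define S where "S = (\<lambda>(k, i, j). max_pow A k $ i $ j) ` ({..<CARD('n)} \<times> UNIV \<times> UNIV)"
  have "bdd_above S" unfolding S_def by (intro bdd_above_finite) auto
  then obtain C where C: "\<And>x. x \<in> S \<Longrightarrow> x \<le> C" unfolding bdd_above_def by blast
  have "max_pow A k $ i $ j \<le> C" if "k < CARD('n)" for k i j
    by (intro C, unfold S_def, rule image_eqI[where x = "(k, i, j)"]) (use that in auto)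
  then show ?thesis
    unfolding power_bounded_def
    by (meson max_pow_le_short_max_pow[OF A cyc] order_trans)
qed

section \<open>The upper limit of the powers\<close>

definition seq_limsup :: "(nat \<Rightarrow> real) \<Rightarrow> real" where
  "seq_limsup a = lim (\<lambda>p. SUP m\<in>{p..}. a m)"

lemma bdd_above_tail: "(\<And>m. a m \<le> C) \<Longrightarrow> bdd_above (a ` {p..})" for a :: "nat \<Rightarrow> real"
  by (auto simp: bdd_above_def)

lemma le_SUP_tail: "(\<And>m. a m \<le> C) \<Longrightarrow> p \<le> m \<Longrightarrow> a m \<le> (SUP m\<in>{p..}. a m)"
  for a :: "nat \<Rightarrow> real"
  by (intro cSUP_upper bdd_above_tail) auto

lemma tail_sup_tendsto_seq_limsup:
  assumes "\<And>m. 0 \<le> a m" "\<And>m. a m \<le> C"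
  shows "(\<lambda>p. SUP m\<in>{p..}. a m) \<longlonglongrightarrow> seq_limsup a"
proof -
  have "decseq (\<lambda>p. SUP m\<in>{p..}. a m)"
    unfolding decseq_def
    by (intro allI impI cSUP_subset_mono bdd_above_tail[where C = C] assms(2)) auto
  moreover have "0 \<le> (SUP m\<in>{p..}. a m)" for p
    using order_trans[OF assms(1) le_SUP_tail[of a, OF assms(2) order_refl]] .
  ultimately show ?thesis
    unfolding seq_limsup_def using decseq_convergent[of _ 0] limI by metis
qed

lemma tendsto_MAX:
  fixes f :: "'n::finite \<Rightarrow> 'a \<Rightarrow> real"
  assumes "\<And>k. (f k \<longlongrightarrow> l k) F"
  shows "((\<lambda>x. MAX k. f k x) \<longlongrightarrow> (MAX k. l k)) F"
proof -
  have "((\<lambda>x. Max ((\<lambda>k. f k x) ` S)) \<longlongrightarrow> Max (l ` S)) F"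
    if "finite S" "S \<noteq> {}" for S :: "'n set"
    using that by (induction S rule: finite_ne_induct) (auto intro!: tendsto_max assms)
  then show ?thesis by simp
qed

text \<open>The exchange is exact already for each tail, before passing to the limit, because
  suprema commute with finite maxima and with nonnegative scaling.\<close>

lemma tail_sup_MAX:
  fixes a :: "'n::finite \<Rightarrow> nat \<Rightarrow> real"
  assumes "\<And>k. 0 \<le> c k" "\<And>k m. 0 \<le> a k m" "\<And>k m. a k m \<le> C"
  shows "(SUP m\<in>{p..}. MAX k. c k * a k m) = (MAX k. c k * (SUP m\<in>{p..}. a k m))" (is "?L = ?R")
proof (rule antisym)
  have "c k * a k m \<le> ?R" if "p \<le> m" for k m
    using mult_left_mono[OF le_SUP_tail[of "a k", OF assms(3) that] assms(1)[of k]]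
      MAX_ge[of "\<lambda>k. c k * (SUP m\<in>{p..}. a k m)" k] by (rule order_trans)
  then show "?L \<le> ?R" by (intro cSUP_least) (auto simp: MAX_le_iff)
  \<comment> \<open>Without a bound on its members the supremum on the left would be an unspecified value.\<close>
  define D where "D = (MAX k. c k * C)"
  have D: "(MAX k. c k * a k m) \<le> D" for m
    unfolding D_def MAX_le_iff
    using mult_left_mono[OF assms(3,1)] MAX_ge[of "\<lambda>k. c k * C"] by (blast intro: order_trans)
  have L: "c k * a k m \<le> ?L" if "p \<le> m" for k m
    using MAX_ge[of "\<lambda>k. c k * a k m" k] le_SUP_tail[of "\<lambda>m. MAX k. c k * a k m", OF D that]
    by (rule order_trans)
  have "c k * (SUP m\<in>{p..}. a k m) \<le> ?L" for k
  proof (cases "c k = 0")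
    case True
    then show ?thesis using L[of p k] by simp
  next
    case False
    then have c: "0 < c k" using assms(1)[of k] by simp
    have "(SUP m\<in>{p..}. a k m) \<le> ?L / c k"
      using L c by (intro cSUP_least) (auto simp: pos_le_divide_eq mult.commute)
    then show ?thesis using c by (simp add: pos_le_divide_eq mult.commute)
  qed
  then show "?R \<le> ?L" by (simp add: MAX_le_iff)
qed

lemma seq_limsup_MAX:
  fixes a :: "'n::finite \<Rightarrow> nat \<Rightarrow> real"
  assumes "\<And>k. 0 \<le> c k" "\<And>k m. 0 \<le> a k m" "\<And>k m. a k m \<le> C"
  shows "seq_limsup (\<lambda>m. MAX k. c k * a k m) = (MAX k. c k * seq_limsup (a k))"
proof -
  have "(\<lambda>p. MAX k. c k * (SUP m\<in>{p..}. a k m)) \<longlonglongrightarrow> (MAX k. c k * seq_limsup (a k))"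
    by (intro tendsto_MAX tendsto_mult_left tail_sup_tendsto_seq_limsup[of _ C] assms)
  then show ?thesis
    unfolding seq_limsup_def[of "\<lambda>m. MAX k. c k * a k m"] tail_sup_MAX[of c, OF assms]
    by (rule limI)
qed

lemma seq_limsup_const: "seq_limsup (\<lambda>_. c) = c"
  by (simp add: seq_limsup_def)

lemma seq_limsup_Suc:
  assumes "\<And>m. 0 \<le> a m" "\<And>m. a m \<le> C"
  shows "seq_limsup (\<lambda>m. a (Suc m)) = seq_limsup a"
proof -
  have "(SUP m\<in>{p..}. a (Suc m)) = (SUP m\<in>{Suc p..}. a m)" for p
    using image_image[of a Suc "{p..}"] image_add_atLeast[of 1 p] by simp
  then show ?thesis
    using LIMSEQ_Suc[OF tail_sup_tendsto_seq_limsup[OF assms]]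
    unfolding seq_limsup_def[of "\<lambda>m. a (Suc m)"] by (simp add: limI)
qed

lemma le_seq_limsup:
  assumes "\<And>m. 0 \<le> a m" "\<And>m. a m \<le> C" "\<And>p. \<exists>m\<ge>p. c \<le> a m"
  shows "c \<le> seq_limsup a"
proof (rule LIMSEQ_le_const[OF tail_sup_tendsto_seq_limsup[OF assms(1,2)]])
  have "c \<le> (SUP m\<in>{p..}. a m)" for p
    using assms(3)[of p] le_SUP_tail[of a, OF assms(2)] by (meson order_trans)
  then show "\<exists>N. \<forall>n\<ge>N. c \<le> (SUP m\<in>{n..}. a m)" by blast
qed

section \<open>The spectral projector\<close>

lemma spectral_proj_nth: "spectral_proj A $ i $ j = seq_limsup (\<lambda>m. max_pow A m $ i $ j)"
  by (simp add: spectral_proj_def seq_limsup_def)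

text \<open>Boundedness, rather than Perron root \<open>1\<close>, is what makes the upper limits genuine. The Perron root
  is itself identified by means of the projector of a rescaled matrix, so the projector has
  to be available before the Perron root is known.\<close>

locale power_bounded_mat =
  fixes A :: "real ^ 'n ^ 'n"
  assumes nonneg: "nonneg_mat A" and bounded: "power_bounded A"
begin

definition bound :: real where "bound = (SOME C. \<forall>m i j. max_pow A m $ i $ j \<le> C)"

lemma max_pow_le_bound: "max_pow A m $ i $ j \<le> bound"
  using someI_ex[OF bounded[unfolded power_bounded_def]] unfolding bound_def by blast

lemma max_pow_nonneg: "0 \<le> max_pow A m $ i $ j"
  by (simp add: nonneg_matD nonneg nonneg_max_pow)

lemma nonneg_spectral_proj: "nonneg_mat (spectral_proj A)"
  unfolding nonneg_mat_def spectral_proj_nth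
  by (intro allI le_seq_limsup[OF max_pow_nonneg max_pow_le_bound]) (auto intro: max_pow_nonneg)

lemma max_mult_spectral_proj_nth:
  assumes "nonneg_mat B"
  shows "(B \<otimes> spectral_proj A) $ i $ j = seq_limsup (\<lambda>m. (B \<otimes> max_pow A m) $ i $ j)"
  unfolding max_mult_nth spectral_proj_nth
  by (rule seq_limsup_MAX[symmetric, OF _ max_pow_nonneg max_pow_le_bound])
    (simp add: assms nonneg_matD)

lemma spectral_proj_max_mult_nth:
  assumes "nonneg_mat B"
  shows "(spectral_proj A \<otimes> B) $ i $ j = seq_limsup (\<lambda>m. (max_pow A m \<otimes> B) $ i $ j)"
  unfolding max_mult_nth spectral_proj_nth mult.commute[of _ "B $ _ $ _"]
  by (rule seq_limsup_MAX[symmetric, OF _ max_pow_nonneg max_pow_le_bound])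
    (simp add: assms nonneg_matD)

lemma spectral_proj_max_mult_vec_nth:
  assumes "nonneg_vec v"
  shows "(spectral_proj A \<otimes>\<^sub>v v) $ i = seq_limsup (\<lambda>m. (max_pow A m \<otimes>\<^sub>v v) $ i)"
  unfolding max_mult_vec_nth spectral_proj_nth mult.commute[of _ "v $ _"]
  by (rule seq_limsup_MAX[symmetric, OF _ max_pow_nonneg max_pow_le_bound])
    (use assms in \<open>simp add: nonneg_vec_def\<close>)

lemma mult_spectral_proj: "A \<otimes> spectral_proj A = spectral_proj A"
  unfolding vec_eq_iff max_mult_spectral_proj_nth[OF nonneg] max_pow_Suc_left[OF nonneg]
    spectral_proj_nth
  by (intro allI seq_limsup_Suc[OF max_pow_nonneg max_pow_le_bound])

lemma eigencone_1_iff_spectral_proj: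
  "v \<in> eigencone A 1 \<longleftrightarrow> nonneg_vec v \<and> spectral_proj A \<otimes>\<^sub>v v = v"
proof safe
  assume v: "v \<in> eigencone A 1"
  then show nv: "nonneg_vec v" by (simp add: eigencone_def)
  have "max_pow A m \<otimes>\<^sub>v v = v" for m
    using max_pow_mult_vec_eigen[OF nonneg _ v] by simp
  then show "spectral_proj A \<otimes>\<^sub>v v = v"
    by (simp add: vec_eq_iff spectral_proj_max_mult_vec_nth[OF nv] seq_limsup_const)
next
  assume v: "nonneg_vec v" "spectral_proj A \<otimes>\<^sub>v v = v"
  have "A \<otimes>\<^sub>v v = v"
    using max_mult_vec_assoc[OF nonneg v(1), of "spectral_proj A"]
    by (simp add: v(2) mult_spectral_proj)
  then show "v \<in> eigencone A 1" by (simp add: eigencone_def v(1))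
qed

lemma eigencone_1_eq_max_image: "eigencone A 1 = max_image (spectral_proj A)"
proof
  show "eigencone A 1 \<subseteq> max_image (spectral_proj A)"
    unfolding max_image_def by (auto simp: eigencone_1_iff_spectral_proj) metis
  show "max_image (spectral_proj A) \<subseteq> eigencone A 1"
    unfolding max_image_def eigencone_def
    by (auto simp: nonneg_max_mult_vec nonneg_spectral_proj mult_spectral_proj
        simp flip: max_mult_vec_assoc[OF nonneg])
qed

lemma spectral_proj_idem: "spectral_proj A \<otimes> spectral_proj A = spectral_proj A"
proof -
  have "max_pow A m \<otimes> spectral_proj A = spectral_proj A" for m
    by (induction m)
      (simp_all add: max_mult_one_left nonneg_spectral_proj max_mult_assoc nonneg_max_pow nonneg
        mult_spectral_proj)
  then show ?thesis
    by (simp add: vec_eq_iff spectral_proj_max_mult_nth nonneg_spectral_proj seq_limsup_const)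
qed

lemma spectral_proj_commute:
  assumes "nonneg_mat B" "A \<otimes> B = B \<otimes> A"
  shows "spectral_proj A \<otimes> B = B \<otimes> spectral_proj A"
  by (simp add: vec_eq_iff spectral_proj_max_mult_nth max_mult_spectral_proj_nth
      max_pow_commute[OF nonneg] assms)

end

section \<open>The Perron root bounds the cycles\<close>

lemma perron_root_eqI:
  assumes "max_eigenvalue A \<mu>" "\<And>\<alpha>. max_eigenvalue A \<alpha> \<Longrightarrow> \<alpha> \<le> \<mu>"
  shows "perron_root A = \<mu>"
  unfolding perron_root_def using assms by (rule Greatest_equality)

text \<open>An eigenvector for \<open>\<alpha>\<close> is scaled by \<open>\<alpha>\<^sup>m\<close> under \<open>A\<^sup>m\<close>, which is incompatible with bounded powers
  when \<open>\<alpha> > 1\<close>.\<close>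

lemma (in power_bounded_mat) max_eigenvalue_le_1:
  assumes "max_eigenvalue A \<alpha>"
  shows "\<alpha> \<le> 1"
proof (rule ccontr)
  assume "\<not> \<alpha> \<le> 1"
  obtain v where a: "0 \<le> \<alpha>" and v: "v \<in> eigencone A \<alpha>" and "v \<noteq> 0"
    using assms unfolding max_eigenvalue_def by blast
  have nv: "nonneg_vec v" using v by (simp add: eigencone_def)
  with \<open>v \<noteq> 0\<close> obtain i where i: "0 < v $ i"
    by (metis nonneg_vec_def order_le_less vec_eq_iff zero_index)
  define D where "D = (MAX k. bound * v $ k)"
  obtain m where m: "D / v $ i < \<alpha> ^ m"
    using real_arch_pow[of \<alpha>] \<open>\<not> \<alpha> \<le> 1\<close> by auto
  have "\<alpha> ^ m * v $ i = (max_pow A m \<otimes>\<^sub>v v) $ i"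
    by (simp add: max_pow_mult_vec_eigen[OF nonneg a v])
  also have "\<dots> \<le> D"
    unfolding D_def max_mult_vec_nth MAX_le_iff
  proof
    fix k
    have "max_pow A m $ i $ k * v $ k \<le> bound * v $ k"
      using nv by (intro mult_right_mono max_pow_le_bound) (simp add: nonneg_vec_def)
    also have "\<dots> \<le> (MAX k. bound * v $ k)" by (rule MAX_ge)
    finally show "max_pow A m $ i $ k * v $ k \<le> (MAX k. bound * v $ k)" .
  qed
  finally show False using m i by (simp add: pos_divide_less_eq)
qed

text \<open>After scaling by \<open>1 / \<mu>\<close> no cycle weighs more than \<open>1\<close>, and repeating the critical cycle keeps
  the diagonal entry at \<open>i0\<close> at least \<open>1\<close> along a subsequence of the powers. This makes column
  \<open>i0\<close> of the projector nonzero, hence an eigenvector.\<close>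

lemma perron_root_eq_max_cycle_mean:
  fixes A :: "real ^ 'n ^ 'n"
  assumes A: "nonneg_mat A" and \<mu>: "0 < \<mu>"
    and cyc: "\<And>k i. 1 \<le> k \<Longrightarrow> k \<le> CARD('n) \<Longrightarrow> max_pow A k $ i $ i \<le> \<mu> ^ k"
    and crit: "1 \<le> k0" "max_pow A k0 $ i0 $ i0 = \<mu> ^ k0"
  shows "perron_root A = \<mu>"
proof -
  define B where "B = (1 / \<mu>) *\<^sub>R A"
  have AB: "A = \<mu> *\<^sub>R B" using \<mu> by (simp add: B_def)
  have pB: "max_pow B m $ i $ j = max_pow A m $ i $ j / \<mu> ^ m" for m i j
    using \<mu> by (simp add: B_def max_pow_scale power_one_over field_simps)
  have B: "nonneg_mat B" using A \<mu> by (simp add: B_def nonneg_mat_def)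
  interpret power_bounded_mat B
    by (standard, fact B, intro power_bounded_if_cycles_le_1 B) (use cyc \<mu> in \<open>simp add: pB\<close>)
  \<comment> \<open>Going \<open>p\<close> times round the critical cycle, whose rescaled weight is \<open>1\<close>.\<close>
  have return: "1 \<le> max_pow B (p * k0) $ i0 $ i0" for p
  proof (induction p)
    case 0
    show ?case by (simp add: mat_def)
  next
    case (Suc p)
    have "1 \<le> max_pow B (p * k0) $ i0 $ i0 * max_pow B k0 $ i0 $ i0"
      using Suc crit(2) \<mu> by (simp add: pB[of k0])
    also have "\<dots> \<le> max_pow B (p * k0 + k0) $ i0 $ i0"
      unfolding max_pow_add[OF B] max_mult_nth by (rule MAX_ge)
    finally show ?case by (simp add: add.commute)
  qed
  define v where "v = column i0 (spectral_proj B)"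
  have "1 \<le> v $ i0"
    unfolding v_def column_def vec_lambda_beta spectral_proj_nth
    by (rule le_seq_limsup[OF max_pow_nonneg max_pow_le_bound])
      (use return crit(1) in \<open>metis le_square mult.commute mult_le_mono2 nat_mult_1 nat_mult_1_right\<close>)
  then have "v \<noteq> 0" by auto
  have "B \<otimes>\<^sub>v v = v"
    unfolding v_def by (simp flip: column_max_mult add: mult_spectral_proj)
  then have "A \<otimes>\<^sub>v v = \<mu> *\<^sub>R v" using \<mu> by (simp add: AB max_mult_vec_scale)
  moreover have "nonneg_vec v"
    using nonneg_spectral_proj by (simp add: v_def nonneg_vec_def column_def nonneg_mat_def)
  ultimately have "max_eigenvalue A \<mu>"
    using \<open>v \<noteq> 0\<close> \<mu> by (auto simp: max_eigenvalue_def eigencone_def)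
  moreover have "\<alpha> \<le> \<mu>" if "max_eigenvalue A \<alpha>" for \<alpha>
  proof -
    have "max_eigenvalue B (\<alpha> / \<mu>)"
      using that \<mu> by (auto simp: max_eigenvalue_def eigencone_def B_def max_mult_vec_scale)
    then have "\<alpha> / \<mu> \<le> 1" by (rule max_eigenvalue_le_1)
    then show ?thesis using \<mu> by simp
  qed
  ultimately show ?thesis by (rule perron_root_eqI)
qed

text \<open>For maximal cycle mean \<open>0\<close> the bound on the cycles is immediate; only a positive
  mean has to be compared with the Perron root.\<close>

lemma power_bounded_if_perron_root_1:
  fixes A :: "real ^ 'n ^ 'n"
  assumes A: "nonneg_mat A" and "perron_root A = 1"
  shows "power_bounded A"
proof -
  define S where "S = (\<lambda>(k, i). root k (max_pow A k $ i $ i)) ` ({1..CARD('n)} \<times> UNIV)"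
  define \<mu> where "\<mu> = Max S"
  have "finite S" "S \<noteq> {}" by (auto simp: S_def Suc_le_eq)
  then have "\<mu> \<in> S" unfolding \<mu>_def by (rule Max_in)
  then obtain k0 i0 where k0: "1 \<le> k0" "\<mu> = root k0 (max_pow A k0 $ i0 $ i0)"
    by (auto simp: S_def)
  have nn: "0 \<le> max_pow A k $ i $ i" for k i
    by (simp add: A nonneg_matD nonneg_max_pow)
  have cyc: "max_pow A k $ i $ i \<le> \<mu> ^ k" if "1 \<le> k" "k \<le> CARD('n)" for k i
  proof -
    have "root k (max_pow A k $ i $ i) \<in> S" using that by (force simp: S_def)
    then have "root k (max_pow A k $ i $ i) \<le> \<mu>"
      unfolding \<mu>_def using \<open>finite S\<close> by simp
    then have "root k (max_pow A k $ i $ i) ^ k \<le> \<mu> ^ k"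
      by (rule power_mono) (use nn that in simp)
    then show ?thesis using that nn by simp
  qed
  have "0 \<le> \<mu>" using k0 nn by simp
  have "\<mu> \<le> 1"
  proof (cases "\<mu> = 0")
    case False
    then have "0 < \<mu>" using \<open>0 \<le> \<mu>\<close> by simp
    moreover have "max_pow A k0 $ i0 $ i0 = \<mu> ^ k0" using k0 nn by simp
    ultimately have "perron_root A = \<mu>"
      using cyc k0(1) by (intro perron_root_eq_max_cycle_mean[OF A])
    then show ?thesis using assms(2) by simp
  qed simp
  then have "\<mu> ^ k \<le> 1" for k using \<open>0 \<le> \<mu>\<close> by (rule power_le_one[rotated])
  then show ?thesis
    using cyc by (intro power_bounded_if_cycles_le_1[OF A]) (meson order_trans)
qed

section \<open>Products of commuting projectors\<close>

text \<open>From \<open>P v = \<alpha> v\<close> idempotence gives \<open>\<alpha>\<^sup>2 v = \<alpha> v\<close>. For the direction from the Perron root to the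
  eigenvector, \<open>perron_root\<close> is an unspecified value unless a greatest eigenvalue exists; this is
  why the proof shows that without fixed vectors \<open>P\<close> vanishes and its Perron root is \<open>0\<close>.\<close>

lemma perron_root_idempotent:
  assumes P: "nonneg_mat P" "P \<otimes> P = P"
  shows "perron_root P = 1 \<longleftrightarrow> (\<exists>v\<in>eigencone P 1. v \<noteq> 0)"
proof -
  have le: "\<alpha> \<in> {0, 1}" if "max_eigenvalue P \<alpha>" for \<alpha>
  proof -
    obtain v where v: "0 \<le> \<alpha>" "nonneg_vec v" "P \<otimes>\<^sub>v v = \<alpha> *\<^sub>R v" "v \<noteq> 0"
      using \<open>max_eigenvalue P \<alpha>\<close> by (auto simp: max_eigenvalue_def eigencone_def)
    have "\<alpha> *\<^sub>R v = \<alpha> *\<^sub>R \<alpha> *\<^sub>R v"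
      using max_mult_vec_assoc[OF P(1) v(2), of P] v by (simp add: P(2) max_mult_vec_scale)
    then show ?thesis using v(4) by auto
  qed
  show ?thesis
  proof
    assume "\<exists>v\<in>eigencone P 1. v \<noteq> 0"
    then have "max_eigenvalue P 1" by (simp add: max_eigenvalue_def)
    then show "perron_root P = 1" using le by (intro perron_root_eqI) force+
  next
    assume 1: "perron_root P = 1"
    show "\<exists>v\<in>eigencone P 1. v \<noteq> 0"
    proof (rule ccontr)
      assume neg: "\<not> (\<exists>v\<in>eigencone P 1. v \<noteq> 0)"
      have "column j P \<in> eigencone P 1" for j
        using P by (auto simp: eigencone_def nonneg_vec_def column_def nonneg_mat_def
            simp flip: column_max_mult[unfolded column_def])
      then have "column j P = 0" for j using neg by blast
      then have "P = 0" by (simp add: vec_eq_iff column_def)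
      then have "max_eigenvalue P 0"
        unfolding max_eigenvalue_def eigencone_def
        by (auto intro!: exI[of _ 1] simp: nonneg_vec_def vec_eq_iff max_mult_vec_nth)
      moreover have "\<not> max_eigenvalue P 1" using neg by (simp add: max_eigenvalue_def)
      ultimately have "perron_root P = 0" using le by (intro perron_root_eqI) auto
      with 1 show False by simp
    qed
  qed
qed

lemma max_prod_list_Nil [simp]: "max_prod_list [] = mat 1"
  by (simp add: max_prod_list_def)

lemma max_prod_list_Cons [simp]: "max_prod_list (X # Xs) = X \<otimes> max_prod_list Xs"
  by (simp add: max_prod_list_def)

lemma nonneg_max_prod_list: "\<forall>X\<in>set Xs. nonneg_mat X \<Longrightarrow> nonneg_mat (max_prod_list Xs)"
  by (induction Xs) (auto intro: nonneg_mat_one nonneg_max_mult)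

lemma max_prod_list_fixes:
  assumes "\<forall>X\<in>set Xs. nonneg_mat X \<and> X \<otimes>\<^sub>v v = v" "nonneg_vec v"
  shows "max_prod_list Xs \<otimes>\<^sub>v v = v"
  using assms by (induction Xs) (auto simp: max_mult_vec_one max_mult_vec_assoc)

text \<open>The factor \<open>X\<close> can be moved next to its own occurrence in the list, where idempotence removes it.\<close>

lemma max_prod_list_absorb:
  assumes "\<forall>X\<in>set Xs. nonneg_mat X \<and> X \<otimes> X = X" "\<forall>X\<in>set Xs. \<forall>Y\<in>set Xs. X \<otimes> Y = Y \<otimes> X"
    "X \<in> set Xs"
  shows "X \<otimes> max_prod_list Xs = max_prod_list Xs"
  using assms
proof (induction Xs)
  case (Cons Y Ys)
  let ?R = "max_prod_list Ys"
  have n: "nonneg_mat X" "nonneg_mat Y" "nonneg_mat ?R"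
    using Cons.prems by (auto intro: nonneg_max_prod_list)
  show ?case
  proof (cases "X = Y")
    case True
    then show ?thesis using n Cons.prems by (simp flip: max_mult_assoc)
  next
    case False
    then have "X \<otimes> ?R = ?R" using Cons by auto
    moreover have "X \<otimes> (Y \<otimes> ?R) = Y \<otimes> (X \<otimes> ?R)"
      using n Cons.prems by (auto simp flip: max_mult_assoc)
    ultimately show ?thesis by simp
  qed
qed simp

lemma max_prod_list_mult_absorb:
  assumes "\<forall>X\<in>set Xs. nonneg_mat X \<and> X \<otimes> B = B" "nonneg_mat B"
  shows "max_prod_list Xs \<otimes> B = B"
  using assms by (induction Xs) (auto simp: max_mult_one_left max_mult_assoc)

theorem mainTheorem6:
  fixes A :: "nat \<Rightarrow> real ^ 'n ^ 'n" and r :: nat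
  assumes "1 \<le> r"
    and "\<And>i. i \<in> {1..r} \<Longrightarrow> nonneg_mat (A i)"
    and "\<And>i j. i \<in> {1..r} \<Longrightarrow> j \<in> {1..r} \<Longrightarrow> A i \<otimes> A j = A j \<otimes> A i"
    and "\<And>i. i \<in> {1..r} \<Longrightarrow> perron_root (A i) = 1"
  defines "P \<equiv> max_prod_list (map (\<lambda>i. spectral_proj (A i)) [1..<Suc r])"
  shows "(\<Inter>i\<in>{1..r}. eigencone (A i) 1) = (\<Inter>i\<in>{1..r}. max_image (spectral_proj (A i)))
    \<and> (\<Inter>i\<in>{1..r}. max_image (spectral_proj (A i))) = eigencone P 1
    \<and> ((\<exists>v \<in> (\<Inter>i\<in>{1..r}. eigencone (A i) 1). v \<noteq> 0) \<longleftrightarrow> perron_root P = 1)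
    \<and> (perron_root P = 1 \<longrightarrow> (\<Inter>i\<in>{1..r}. eigencone (A i) 1) = principal_eigencone P)"
proof -
  let ?Q = "\<lambda>i. spectral_proj (A i)"
  define Qs where "Qs = map ?Q [1..<Suc r]"
  have set_Qs: "set Qs = ?Q ` {1..r}"
    by (simp add: Qs_def atLeastLessThanSuc_atLeastAtMost del: upt_Suc)
  have P: "P = max_prod_list Qs" by (simp add: P_def Qs_def)
  have pb: "power_bounded_mat (A i)" if "i \<in> {1..r}" for i
    using that assms by (intro power_bounded_mat.intro power_bounded_if_perron_root_1)
  note nonneg_Q = power_bounded_mat.nonneg_spectral_proj[OF pb]
  have comm: "?Q i \<otimes> ?Q j = ?Q j \<otimes> ?Q i" if i: "i \<in> {1..r}" and j: "j \<in> {1..r}" for i j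
  proof -
    have "?Q i \<otimes> A j = A j \<otimes> ?Q i"
      using i j assms by (intro power_bounded_mat.spectral_proj_commute[OF pb]) auto
    then show ?thesis
      by (intro power_bounded_mat.spectral_proj_commute[OF pb[OF j] nonneg_Q[OF i], symmetric]) simp
  qed
  have nP: "nonneg_mat P"
    unfolding P by (rule nonneg_max_prod_list) (auto simp: set_Qs nonneg_Q)
  have absorb: "?Q i \<otimes> P = P" if "i \<in> {1..r}" for i
    unfolding P
    by (rule max_prod_list_absorb)
      (use that in \<open>auto simp: set_Qs nonneg_Q comm power_bounded_mat.spectral_proj_idem[OF pb]\<close>)
  have "P \<otimes> P = P"
    using max_prod_list_mult_absorb[of Qs P] nP absorb nonneg_Q
    unfolding set_Qs by (simp add: P[symmetric])
  have image: "(\<Inter>i\<in>{1..r}. eigencone (A i) 1) = (\<Inter>i\<in>{1..r}. max_image (?Q i))"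
    using power_bounded_mat.eigencone_1_eq_max_image[OF pb] by simp
  have cone: "(\<Inter>i\<in>{1..r}. eigencone (A i) 1) = eigencone P 1"
  proof (intro equalityI subsetI)
    fix v assume "v \<in> (\<Inter>i\<in>{1..r}. eigencone (A i) 1)"
    then have v: "nonneg_vec v \<and> ?Q i \<otimes>\<^sub>v v = v" if "i \<in> {1..r}" for i
      using that power_bounded_mat.eigencone_1_iff_spectral_proj[OF pb] by blast
    then have nv: "nonneg_vec v" using assms(1) by (metis atLeastAtMost_iff order_refl)
    have "P \<otimes>\<^sub>v v = v"
      unfolding P using v nonneg_Q
      by (intro max_prod_list_fixes nv) (auto simp: set_Qs)
    then show "v \<in> eigencone P 1" using nv by (simp add: eigencone_def)
  next
    fix v assume "v \<in> eigencone P 1"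
    then have v: "nonneg_vec v" "P \<otimes>\<^sub>v v = v" by (auto simp: eigencone_def)
    have "?Q i \<otimes>\<^sub>v v = v" if i: "i \<in> {1..r}" for i
      using max_mult_vec_assoc[OF nonneg_Q[OF i] v(1), of P] by (simp add: absorb[OF i] v(2))
    then show "v \<in> (\<Inter>i\<in>{1..r}. eigencone (A i) 1)"
      using v(1) power_bounded_mat.eigencone_1_iff_spectral_proj[OF pb] by blast
  qed
  show ?thesis
    using image cone perron_root_idempotent[OF nP \<open>P \<otimes> P = P\<close>]
    by (auto simp: principal_eigencone_def)
qed

end
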